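(* Let $X$ be a Banach space. There is a bijective correspondence between cotranslations $Z:\mathbb{Z}\times\mathbb{Z}\to\mathbb{A}_X$ and nonautonomous linear difference equations $x(n+1)=A(n)x(n)$ with $\mathbb{Z}\ni n\mapsto A(n)\in\mathbb{A}_X$, where the correspondence is given by $$Z(n,m)=\begin{cases}A(n+m-1)A(n+m-2)\cdots A(n) & \text{if } m>0,\\ \mathrm{Id} & \text{if } m=0,\\ A^{-1}(n+m)A^{-1}(n+m+1)\cdots A^{-1}(n-1) & \text{if } m<0.\end{cases}$$
   Context: For a Banach space $X$, $\mathbb{A}_X$ is the group of all continuous linear bijections $X\to X$ with continuous inverse. A difference equation $x(n+1)=A(n)x(n)$ is identified with its coefficient function $A:\mathbb{Z}\to\mathbb{A}_X$. $A^{-1}(n)$ denotes $A(n)^{-1}$. For a group $G$, a cotranslation is a map $Z:G\times G\to\mathbb{A}_X$ with $Z(g,kh)=Z(hg,k)\,Z(g,h)$ for all $g,h,k\in G$ (equivalently, a groupoid morphism from the left translations groupoid $G\times G$ to the group $\mathbb{A}_X$). For $G=\mathbb{Z}$ (additive) this reads $Z(n,k+h)=Z(n+h,k)Z(n,h)$. *)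

theory Defs
  imports "HOL-Analysis.Analysis"
begin

text \<open>
  The class \<open>banach\<close> only provides real scalars. The locale adds a scalar field, so that real and
  complex Banach spaces are both covered: by the commutative Gelfand--Mazur theorem, the instances
  of \<open>real_normed_field\<close> are, up to isomorphism, exactly the real and the complex numbers.
\<close>

locale banach_space = vector_space scl
  for scl :: "'k::real_normed_field \<Rightarrow> 'a::banach \<Rightarrow> 'a" +
  assumes scale_of_real: "scl (of_real r) x = r *\<^sub>R x"
    and norm_scale: "norm (scl c x) = norm c * norm x"

lemma banach_space_scaleR: "banach_space (scaleR :: real \<Rightarrow> 'a::banach \<Rightarrow> 'a)"
  by unfold_locales (simp_all add: algebra_simps)

lemma banach_space_complex: "banach_space ((*) :: complex \<Rightarrow> complex \<Rightarrow> complex)"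
  by unfold_locales (simp_all add: algebra_simps scaleR_conv_of_real norm_mult)

definition automorphisms :: "('k::real_normed_field \<Rightarrow> 'a::banach \<Rightarrow> 'a) \<Rightarrow> ('a \<Rightarrow> 'a) set" where
  "automorphisms scl =
     {T. Vector_Spaces.linear scl scl T \<and> continuous_on UNIV T \<and>
         bij T \<and> continuous_on UNIV (inv T)}"

text \<open>
  The class \<open>group_add\<close> does not assume commutativity, so the order of the summands matters:
  in multiplicative notation the identity reads \<open>Z(g, kh) = Z(hg, k) Z(g, h)\<close>.
\<close>

definition cotranslation ::
  "('k::real_normed_field \<Rightarrow> 'a::banach \<Rightarrow> 'a) \<Rightarrow> ('g::group_add \<times> 'g \<Rightarrow> 'a \<Rightarrow> 'a) \<Rightarrow> bool" where
  "cotranslation scl Z \<longleftrightarrow>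
     (\<forall>g h. Z (g, h) \<in> automorphisms scl) \<and>
     (\<forall>g h k. Z (g, k + h) = Z (h + g, k) \<circ> Z (g, h))"

text \<open>A difference equation \<open>x(n+1) = A(n) x(n)\<close> is identified with its coefficient function.\<close>

definition difference_equations ::
  "('k::real_normed_field \<Rightarrow> 'a::banach \<Rightarrow> 'a) \<Rightarrow> (int \<Rightarrow> 'a \<Rightarrow> 'a) set" where
  "difference_equations scl = {A. \<forall>n. A n \<in> automorphisms scl}"

definition compose_list :: "('a \<Rightarrow> 'a) list \<Rightarrow> 'a \<Rightarrow> 'a" where
  "compose_list Ts = foldr (\<circ>) Ts id"

text \<open>
  The leftmost list entry is the outermost factor: the list of factors is
  \<open>A(n+m-1), \<dots>, A(n)\<close> for \<open>m > 0\<close> and \<open>A\<^sup>-\<^sup>1(n+m), \<dots>, A\<^sup>-\<^sup>1(n-1)\<close> for \<open>m < 0\<close>.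
\<close>

definition transition :: "(int \<Rightarrow> 'a \<Rightarrow> 'a) \<Rightarrow> int \<times> int \<Rightarrow> 'a \<Rightarrow> 'a" where
  "transition A = (\<lambda>(n, m).
     if m > 0 then compose_list (map A (rev [n..n + m - 1]))
     else if m = 0 then id
     else compose_list (map (\<lambda>j. inv (A j)) [n + m..n - 1]))"

end

theory Submission
  imports Defs
begin

text \<open>
  Both directions rest on one fact: for bijective coefficients, a solution \<open>F\<close> of
  \<open>F(m+1) = B(m) F(m)\<close> on all of \<open>\<int>\<close> is determined by \<open>F(0)\<close>. The map \<open>m \<mapsto> transition A (n, m)\<close> is
  the solution for \<open>B(m) = A(n+m)\<close> with initial value \<open>id\<close>, and both sides of the cotranslation
  identity, as functions of \<open>k\<close>, solve the same equation. Conversely, a cotranslation \<open>Z\<close> solves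
  this equation with \<open>A(n) = Z(n, 1)\<close>.
\<close>

lemma automorphisms_bij: "T \<in> automorphisms scl \<Longrightarrow> bij T"
  by (simp add: automorphisms_def)

lemma automorphisms_id:
  assumes "vector_space scl"
  shows "id \<in> automorphisms scl"
  using vector_space.linear_id[OF assms]
  by (simp add: automorphisms_def inv_id)

lemma automorphisms_comp:
  assumes "S \<in> automorphisms scl" "T \<in> automorphisms scl"
  shows "S \<circ> T \<in> automorphisms scl"
proof -
  have "inv (S \<circ> T) = inv T \<circ> inv S"
    using assms by (intro o_inv_distrib) (auto simp: automorphisms_def)
  moreover have "continuous_on UNIV (inv T \<circ> inv S)" "continuous_on UNIV (S \<circ> T)"
    using assms
    by (auto simp: automorphisms_def simp del: comp_apply
        intro!: continuous_on_compose intro: continuous_on_subset)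
  ultimately show ?thesis
    using assms by (auto simp: automorphisms_def intro: Vector_Spaces.linear_compose bij_comp)
qed

text \<open>Continuity of the inverse is part of \<open>automorphisms\<close>, and
  \<open>inv (inv T) = T\<close> swaps the two continuity conditions, so only linearity of
  \<open>inv T\<close> takes work.\<close>

lemma automorphisms_inv:
  assumes "T \<in> automorphisms scl"
  shows "inv T \<in> automorphisms scl"
proof -
  have T: "Vector_Spaces.linear scl scl T" "bij T"
    using assms by (auto simp: automorphisms_def)
  interpret Vector_Spaces.linear scl scl T by (fact T(1))
  have "inv T (x + y) = inv T x + inv T y" "inv T (scl c x) = scl c (inv T x)" for x y c
    using T(2) by (auto intro!: inv_f_eq simp: add scale bij_is_inj bij_is_surj surj_f_inv_f)
  then have "Vector_Spaces.linear scl scl (inv T)"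
    by unfold_locales
  then show ?thesis
    using assms by (simp add: automorphisms_def bij_imp_bij_inv inv_inv_eq)
qed

text \<open>Upwards, the recurrence produces the next value. Downwards, \<open>F (i - 1)\<close> and
  \<open>G (i - 1)\<close> have the same image under \<open>B (i - 1)\<close>, and injectivity
  cancels it.\<close>

lemma two_sided_recurrence_unique:
  fixes F G :: "int \<Rightarrow> 'b \<Rightarrow> 'a"
  assumes inj: "\<And>m. inj (B m)"
    and F: "\<And>m. F (m + 1) = B m \<circ> F m" and G: "\<And>m. G (m + 1) = B m \<circ> G m"
    and "F 0 = G 0"
  shows "F m = G m"
proof (induction m rule: int_induct[where k = 0])
  case base
  show ?case by (fact assms(4))
next
  case (step1 i)
  then show ?case by (simp add: F G)
next
  case (step2 i)
  have "B (i - 1) \<circ> F (i - 1) = B (i - 1) \<circ> G (i - 1)"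
    using step2 F[of "i - 1"] G[of "i - 1"] by simp
  then show ?case
    using inj[of "i - 1"] by (simp add: fun.inj_map_strong fun_eq_iff inj_eq)
qed

lemma compose_list_simps [simp]:
  "compose_list [] = id"
  "compose_list (T # Ts) = T \<circ> compose_list Ts"
  by (simp_all add: compose_list_def)

lemma transition_0 [simp]: "transition A (n, 0) = id"
  by (simp add: transition_def)

text \<open>For \<open>m \<ge> 0\<close> the factor \<open>A (n + m)\<close> joins the product as
  its outermost entry. For \<open>m < 0\<close> the product at \<open>m\<close> has
  \<open>inv (A (n + m))\<close> outermost, and \<open>A (n + m)\<close> cancels it.\<close>

lemma transition_step:
  assumes "\<And>n. bij (A n)"
  shows "transition A (n, m + 1) = A (n + m) \<circ> transition A (n, m)"
proof (cases "m \<ge> 0")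
  case True
  then have "[n..n + m] = [n..n + m - 1] @ [n + m]"
    by (intro upto_rec2) simp
  with True show ?thesis
    by (auto simp: transition_def)
next
  case False
  then have "[n + m..n - 1] = (n + m) # [n + m + 1..n - 1]"
    by (intro upto_rec1) simp
  \<comment> \<open>If \<open>m = -1\<close>, the remaining list \<open>[n..n - 1]\<close> is empty,
    which agrees with the separate value \<open>id\<close> at \<open>m + 1 = 0\<close>.\<close>
  with False have "transition A (n, m) = inv (A (n + m)) \<circ> transition A (n, m + 1)"
    by (auto simp: transition_def add.assoc)
  moreover have "A (n + m) \<circ> inv (A (n + m)) = id"
    using assms by (simp add: bij_is_surj surj_iff[symmetric])
  ultimately show ?thesis
    by (metis comp_assoc id_comp)
qed

lemma transition_automorphism:
  assumes "vector_space scl" and A: "\<And>n. A n \<in> automorphisms scl"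
  shows "transition A (n, m) \<in> automorphisms scl"
proof -
  have "compose_list Ts \<in> automorphisms scl" if "set Ts \<subseteq> automorphisms scl" for Ts
    using that by (induction Ts) (auto intro: automorphisms_id automorphisms_comp assms(1))
  then show ?thesis
    using A assms(1) by (auto simp: transition_def image_subset_iff automorphisms_id automorphisms_inv)
qed

lemma cotranslation_transition:
  assumes "vector_space scl" and A: "A \<in> difference_equations scl"
  shows "cotranslation scl (transition A)"
proof -
  have aut: "A n \<in> automorphisms scl" for n
    using A by (simp add: difference_equations_def)
  then have bij: "bij (A n)" for n
    by (rule automorphisms_bij)
  have "transition A (g, k + h) = transition A (h + g, k) \<circ> transition A (g, h)" for g h k
  \<comment> \<open>Varying \<open>k\<close> with \<open>g\<close> and \<open>h\<close> fixed avoids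
    a case split on the signs of \<open>k\<close>, \<open>h\<close> and \<open>k + h\<close>; at
    \<open>k = 0\<close> both sides are \<open>transition A (g, h)\<close>.\<close>
  proof (rule two_sided_recurrence_unique
      [where B = "\<lambda>k. A (h + g + k)" and F = "\<lambda>k. transition A (g, k + h)"
        and G = "\<lambda>k. transition A (h + g, k) \<circ> transition A (g, h)"])
    show "inj (A (h + g + m))" for m
      using bij by (rule bij_is_inj)
    show "transition A (g, m + 1 + h) = A (h + g + m) \<circ> transition A (g, m + h)" for m
      using transition_step[of A g "m + h"] bij by (simp add: ac_simps)
    show "transition A (h + g, m + 1) \<circ> transition A (g, h) =
        A (h + g + m) \<circ> (transition A (h + g, m) \<circ> transition A (g, h))" for m
      by (simp add: transition_step[OF bij] comp_assoc)
  qed simp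
  then show ?thesis
    using transition_automorphism[OF assms(1) aut] by (simp add: cotranslation_def)
qed

text \<open>The identity at \<open>k = h = 0\<close> makes \<open>Z (g, 0)\<close> idempotent, and
  an injective idempotent map is \<open>id\<close>. This supplies the initial value for the
  uniqueness argument.\<close>

lemma cotranslation_0:
  assumes "cotranslation scl Z"
  shows "Z (g, 0) = id"
proof -
  have "Z (g, 0 + 0) = Z (0 + g, 0) \<circ> Z (g, 0)" and "Z (g, 0) \<in> automorphisms scl"
    using assms unfolding cotranslation_def by blast+
  then have "Z (g, 0) (Z (g, 0) x) = Z (g, 0) x" and "inj (Z (g, 0))" for x
    by (auto simp: fun_eq_iff automorphisms_bij bij_is_inj)
  then show ?thesis
    by (auto simp: fun_eq_iff inj_eq)
qed

lemma transition_of_cotranslation: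
  assumes Z: "cotranslation scl Z"
  shows "transition (\<lambda>n. Z (n, 1)) = Z"
proof -
  have bij: "bij (Z (n, 1))" for n
    using Z by (auto simp: cotranslation_def intro: automorphisms_bij)
  have "transition (\<lambda>n. Z (n, 1)) (n, m) = Z (n, m)" for n m
  proof (rule two_sided_recurrence_unique
      [where B = "\<lambda>m. Z (n + m, 1)" and F = "\<lambda>m. transition (\<lambda>n. Z (n, 1)) (n, m)"
        and G = "\<lambda>m. Z (n, m)"])
    show "inj (Z (n + m, 1))" for m
      using bij by (rule bij_is_inj)
    show "transition (\<lambda>n. Z (n, 1)) (n, m + 1) =
        Z (n + m, 1) \<circ> transition (\<lambda>n. Z (n, 1)) (n, m)" for m
      using bij by (rule transition_step)
    \<comment> \<open>Taking \<open>k = 1\<close> and \<open>h = m\<close> puts the one-step factor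
      outermost, as the recurrence requires; the opposite choice would put \<open>Z (n, 1)\<close>
      innermost.\<close>
    have "Z (n, 1 + m) = Z (m + n, 1) \<circ> Z (n, m)" for m
      using Z unfolding cotranslation_def by blast
    then show "Z (n, m + 1) = Z (n + m, 1) \<circ> Z (n, m)" for m
      by (metis add.commute)
  qed (simp add: cotranslation_0[OF Z])
  then show ?thesis
    by auto
qed

theorem proposition3p13:
  fixes scl :: "'k::real_normed_field \<Rightarrow> 'a::banach \<Rightarrow> 'a"
  assumes "banach_space scl"
  shows "bij_betw transition (difference_equations scl)
           {Z :: int \<times> int \<Rightarrow> 'a \<Rightarrow> 'a. cotranslation scl Z}"
proof (rule bij_betwI[where g = "\<lambda>Z n. Z (n, 1)"])
  have "vector_space scl"
    using assms by (simp add: banach_space_def)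
  then show "transition \<in> difference_equations scl \<rightarrow> {Z. cotranslation scl Z}"
    by (auto intro: cotranslation_transition)
  show "(\<lambda>Z n. Z (n, 1)) \<in> {Z. cotranslation scl Z} \<rightarrow> difference_equations scl"
    by (auto simp: cotranslation_def difference_equations_def)
  \<comment> \<open>At \<open>m = 1\<close> the index list is \<open>[n..n]\<close>, so the product
    is the single factor \<open>A n\<close>; hence evaluation at \<open>1\<close> recovers the
    coefficients.\<close>
  show "(\<lambda>n. transition A (n, 1)) = A" if "A \<in> difference_equations scl" for A
    by (simp add: transition_def)
  show "transition (\<lambda>n. Z (n, 1)) = Z" if "Z \<in> {Z. cotranslation scl Z}" for Z
    using that by (simp add: transition_of_cotranslation)
qed

end
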